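(* There is a one-to-one correspondence between flat torsion-free connections $\gamma$ on Lie algebras $\mathfrak g$ and Lagrangian semi-direct products $\mathfrak g\ltimes_\rho V$ (with respect to a symplectic form).
   Context: All Lie algebras are finite dimensional and real. For a vector space $V$ and a representation $\rho:\mathfrak g\to\mathrm{End}(V)$, the semi-direct product $\mathfrak g\ltimes_\rho V$ is the vector space $\mathfrak g\oplus V$ with Lie bracket $[x+u,y+v]=[x,y]+\rho(x)v-\rho(y)u$ for $x,y\in\mathfrak g$, $u,v\in V$. A connection on $\mathfrak g$ (corresponding to a left-invariant affine connection on a Lie group with Lie algebra $\mathfrak g$) is a linear map $\gamma:\mathfrak g\to\mathrm{End}(\mathfrak g)$; it is torsion-free if $[x,y]-\gamma(x)y+\gamma(y)x=0$ for all $x,y\in\mathfrak g$, and flat if $\gamma([x,y])-\gamma(x)\gamma(y)+\gamma(y)\gamma(x)=0$ for all $x,y\in\mathfrak g$. A symplectic form on a Lie algebra is a non-degenerate 2-form that is closed for the Chevalley-Eilenberg differential. The semi-direct product $\mathfrak g\ltimes_\rho V$ is Lagrangian with respect to a non-degenerate 2-form $\omega$ if the subalgebra $\mathfrak g$ and the abelian ideal $V$ are both Lagrangian subspaces for $\omega$, i.e. $\omega$ vanishes on each of them and each has half the dimension of $\mathfrak g\oplus V$. *)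

theory Defs
  imports "HOL-Analysis.Analysis"
begin

text \<open>
  Vector spaces are types of class \<open>real_vector\<close>.  The class \<open>euclidean_space\<close> is avoided because it
  fixes an inner product and excludes the zero space; finite-dimensionality is a predicate instead.
\<close>

definition finite_dim :: "'a::real_vector itself \<Rightarrow> bool" where
  "finite_dim _ \<longleftrightarrow> (\<exists>B. finite B \<and> span B = (UNIV :: 'a set))"

definition lie_algebra :: "('g::real_vector \<Rightarrow> 'g \<Rightarrow> 'g) \<Rightarrow> bool" where
  "lie_algebra br \<longleftrightarrow> finite_dim TYPE('g) \<and> bilinear br \<and> (\<forall>x. br x x = 0) \<and>
     (\<forall>x y z. br x (br y z) + br y (br z x) + br z (br x y) = 0)"

definition representation ::
    "('g::real_vector \<Rightarrow> 'g \<Rightarrow> 'g) \<Rightarrow> ('g \<Rightarrow> 'v::real_vector \<Rightarrow> 'v) \<Rightarrow> bool" where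
  "representation br \<rho> \<longleftrightarrow> bilinear \<rho> \<and>
     (\<forall>x y v. \<rho> (br x y) v = \<rho> x (\<rho> y v) - \<rho> y (\<rho> x v))"

definition semidirect ::
    "('g::real_vector \<Rightarrow> 'g \<Rightarrow> 'g) \<Rightarrow> ('g \<Rightarrow> 'v::real_vector \<Rightarrow> 'v) \<Rightarrow> 'g \<times> 'v \<Rightarrow> 'g \<times> 'v \<Rightarrow> 'g \<times> 'v" where
  "semidirect br \<rho> = (\<lambda>(x, u) (y, v). (br x y, \<rho> x v - \<rho> y u))"

text \<open>\<open>bilinear \<gamma>\<close> says that \<open>\<gamma>\<close> is a linear map into the linear endomorphisms.\<close>

definition connection :: "('g::real_vector \<Rightarrow> 'g \<Rightarrow> 'g) \<Rightarrow> bool" where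
  "connection \<gamma> \<longleftrightarrow> bilinear \<gamma>"

definition torsion_free ::
    "('g::real_vector \<Rightarrow> 'g \<Rightarrow> 'g) \<Rightarrow> ('g \<Rightarrow> 'g \<Rightarrow> 'g) \<Rightarrow> bool" where
  "torsion_free br \<gamma> \<longleftrightarrow> (\<forall>x y. br x y - \<gamma> x y + \<gamma> y x = 0)"

definition flat ::
    "('g::real_vector \<Rightarrow> 'g \<Rightarrow> 'g) \<Rightarrow> ('g \<Rightarrow> 'g \<Rightarrow> 'g) \<Rightarrow> bool" where
  "flat br \<gamma> \<longleftrightarrow> (\<forall>x y z. \<gamma> (br x y) z - \<gamma> x (\<gamma> y z) + \<gamma> y (\<gamma> x z) = 0)"

definition two_form :: "('h::real_vector \<Rightarrow> 'h \<Rightarrow> real) \<Rightarrow> bool" where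
  "two_form \<omega> \<longleftrightarrow> bilinear \<omega> \<and> (\<forall>a. \<omega> a a = 0)"

definition nondegenerate :: "('h::real_vector \<Rightarrow> 'h \<Rightarrow> real) \<Rightarrow> bool" where
  "nondegenerate \<omega> \<longleftrightarrow> (\<forall>a. (\<forall>b. \<omega> a b = 0) \<longrightarrow> a = 0)"

text \<open>The Chevalley-Eilenberg differential (trivial coefficients) in degree two.\<close>

definition ce_diff2 ::
    "('h::real_vector \<Rightarrow> 'h \<Rightarrow> 'h) \<Rightarrow> ('h \<Rightarrow> 'h \<Rightarrow> real) \<Rightarrow> 'h \<Rightarrow> 'h \<Rightarrow> 'h \<Rightarrow> real" where
  "ce_diff2 br \<omega> a b c = - \<omega> (br a b) c + \<omega> (br a c) b - \<omega> (br b c) a"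

definition symplectic_form ::
    "('h::real_vector \<Rightarrow> 'h \<Rightarrow> 'h) \<Rightarrow> ('h \<Rightarrow> 'h \<Rightarrow> real) \<Rightarrow> bool" where
  "symplectic_form br \<omega> \<longleftrightarrow> two_form \<omega> \<and> nondegenerate \<omega> \<and> (\<forall>a b c. ce_diff2 br \<omega> a b c = 0)"

definition lagrangian_subspace :: "('h::real_vector \<Rightarrow> 'h \<Rightarrow> real) \<Rightarrow> 'h set \<Rightarrow> bool" where
  "lagrangian_subspace \<omega> U \<longleftrightarrow> subspace U \<and> (\<forall>a\<in>U. \<forall>b\<in>U. \<omega> a b = 0) \<and>
     2 * dim U = dim (UNIV :: 'h set)"

text \<open>A Lie algebra \<open>(\<gg>, br)\<close> with a connection is a pair \<open>(br, \<gamma>)\<close>; a semi-direct product with a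
  2-form is a triple \<open>(br, \<rho>, \<omega>)\<close>.  The underlying vector spaces are carried by the types.\<close>

type_synonym 'g conn_data = "('g \<Rightarrow> 'g \<Rightarrow> 'g) \<times> ('g \<Rightarrow> 'g \<Rightarrow> 'g)"

type_synonym ('g, 'v) prod_data =
  "('g \<Rightarrow> 'g \<Rightarrow> 'g) \<times> ('g \<Rightarrow> 'v \<Rightarrow> 'v) \<times> ('g \<times> 'v \<Rightarrow> 'g \<times> 'v \<Rightarrow> real)"

definition flat_torsion_free_connections :: "'g::real_vector conn_data set" where
  "flat_torsion_free_connections =
     {(br, \<gamma>). lie_algebra br \<and> connection \<gamma> \<and> flat br \<gamma> \<and> torsion_free br \<gamma>}"

definition lagrangian_products :: "('g::real_vector, 'v::real_vector) prod_data set" where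
  "lagrangian_products =
     {(br, \<rho>, \<omega>). lie_algebra br \<and> finite_dim TYPE('v) \<and> representation br \<rho> \<and>
        symplectic_form (semidirect br \<rho>) \<omega> \<and>
        lagrangian_subspace \<omega> (UNIV \<times> {0}) \<and> lagrangian_subspace \<omega> ({0} \<times> UNIV)}"

text \<open>The connection of a Lagrangian semi-direct product: \<open>\<omega>\<close> pairs \<open>\<gg>\<close> with \<open>V\<close> nondegenerately,
  and \<open>\<gamma> x\<close> is the negative of the transpose of \<open>\<rho> x\<close> under this pairing.\<close>

definition connection_of :: "('g::real_vector, 'v::real_vector) prod_data \<Rightarrow> 'g conn_data" where
  "connection_of = (\<lambda>(br, \<rho>, \<omega>).
     (br, \<lambda>x y. THE z. \<forall>v. \<omega> (z, 0) (0, v) = - \<omega> (y, 0) (0, \<rho> x v)))"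

typedef (overloaded) 'a dual = "{\<alpha> :: 'a::real_vector \<Rightarrow> real. linear \<alpha>}"
  morphisms dual_apply Dual
  by (rule exI[of _ "\<lambda>_. 0"]) (simp add: linear_iff)

setup_lifting type_definition_dual

instantiation dual :: (real_vector) real_vector
begin

lift_definition zero_dual :: "'a dual" is "\<lambda>_. 0"
  by (simp add: linear_iff)

lift_definition plus_dual :: "'a dual \<Rightarrow> 'a dual \<Rightarrow> 'a dual" is "\<lambda>\<alpha> \<beta> x. \<alpha> x + \<beta> x"
  by (simp add: linear_iff algebra_simps)

lift_definition uminus_dual :: "'a dual \<Rightarrow> 'a dual" is "\<lambda>\<alpha> x. - \<alpha> x"
  by (simp add: linear_iff)

lift_definition minus_dual :: "'a dual \<Rightarrow> 'a dual \<Rightarrow> 'a dual" is "\<lambda>\<alpha> \<beta> x. \<alpha> x - \<beta> x"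
  by (simp add: linear_iff algebra_simps)

lift_definition scaleR_dual :: "real \<Rightarrow> 'a dual \<Rightarrow> 'a dual" is "\<lambda>c \<alpha> x. c * \<alpha> x"
  by (simp add: linear_iff algebra_simps)

instance
  by standard (transfer; simp add: fun_eq_iff algebra_simps)+

end

text \<open>The Lagrangian semi-direct product of a connection: \<open>\<gg>\<close> acts on its dual by the dual connection
  \<open>\<alpha> \<mapsto> - \<alpha> \<circ> \<gamma> x\<close>, and \<open>\<omega>\<close> is the canonical 2-form on \<open>\<gg> \<oplus> \<gg>\<^sup>*\<close>.\<close>

definition dual_connection :: "('g::real_vector \<Rightarrow> 'g \<Rightarrow> 'g) \<Rightarrow> 'g \<Rightarrow> 'g dual \<Rightarrow> 'g dual" where
  "dual_connection \<gamma> x \<alpha> = Dual (\<lambda>y. - dual_apply \<alpha> (\<gamma> x y))"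

definition canonical_form :: "'g::real_vector \<times> 'g dual \<Rightarrow> 'g \<times> 'g dual \<Rightarrow> real" where
  "canonical_form = (\<lambda>(x, \<alpha>) (y, \<beta>). dual_apply \<beta> x - dual_apply \<alpha> y)"

definition product_of :: "'g::real_vector conn_data \<Rightarrow> ('g, 'g dual) prod_data" where
  "product_of = (\<lambda>(br, \<gamma>). (br, dual_connection \<gamma>, canonical_form))"

definition conn_isomorphism ::
    "('g::real_vector \<Rightarrow> 'h::real_vector) \<Rightarrow> 'g conn_data \<Rightarrow> 'h conn_data \<Rightarrow> bool" where
  "conn_isomorphism f = (\<lambda>(br, \<gamma>) (br', \<gamma>'). linear f \<and> bij f \<and>
     (\<forall>x y. f (br x y) = br' (f x) (f y)) \<and> (\<forall>x y. f (\<gamma> x y) = \<gamma>' (f x) (f y)))"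

text \<open>Symplectic Lie algebra isomorphisms \<open>f \<oplus> \<phi>\<close> that respect the two summands.\<close>

definition prod_isomorphism ::
    "('g::real_vector \<Rightarrow> 'h::real_vector) \<Rightarrow> ('v::real_vector \<Rightarrow> 'w::real_vector) \<Rightarrow>
     ('g, 'v) prod_data \<Rightarrow> ('h, 'w) prod_data \<Rightarrow> bool" where
  "prod_isomorphism f \<phi> = (\<lambda>(br, \<rho>, \<omega>) (br', \<rho>', \<omega>').
     linear f \<and> bij f \<and> linear \<phi> \<and> bij \<phi> \<and>
     (\<forall>a b. map_prod f \<phi> (semidirect br \<rho> a b) = semidirect br' \<rho>' (map_prod f \<phi> a) (map_prod f \<phi> b)) \<and>
     (\<forall>a b. \<omega>' (map_prod f \<phi> a) (map_prod f \<phi> b) = \<omega> a b))"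

text \<open>Isomorphism over a fixed \<open>\<gg>\<close>: the representation space \<open>V\<close> only matters up to isomorphism.\<close>

definition lagrangian_equiv :: "(('g::real_vector, 'v::real_vector) prod_data \<times> ('g, 'v) prod_data) set" where
  "lagrangian_equiv = {(L, L'). L \<in> lagrangian_products \<and> L' \<in> lagrangian_products \<and>
     (\<exists>\<phi>. prod_isomorphism id \<phi> L L')}"

end

theory Submission
  imports Defs
begin

text \<open>
  A 2-form on \<open>\<gg> \<oplus> V\<close> with both summands Lagrangian is \<open>\<omega> (x, u) (y, v) = p x v - p y u\<close> for a
  perfect pairing \<open>p\<close> of \<open>\<gg>\<close> and \<open>V\<close>.  A representation \<open>\<rho>\<close> on \<open>V\<close> and a connection \<open>\<gamma>\<close> determine each
  other through the adjunction \<open>p (\<gamma> x y) v = - p y (\<rho> x v)\<close>.  Under it, flatness of \<open>\<gamma>\<close> is the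
  representation property of \<open>\<rho>\<close>, and vanishing torsion is closedness of \<open>\<omega>\<close> on \<open>\<gg> \<times> \<gg> \<times> V\<close>, the only
  component of \<open>d\<omega>\<close> that is not automatically zero.  An isomorphism of connections extends uniquely to
  \<open>V\<close> as the inverse transpose with respect to the two pairings.
\<close>

definition perfect_pairing :: "('a::real_vector \<Rightarrow> 'b::real_vector \<Rightarrow> real) \<Rightarrow> bool" where
  "perfect_pairing p \<longleftrightarrow> bilinear p \<and>
     (\<forall>x. (\<forall>v. p x v = 0) \<longrightarrow> x = 0) \<and> (\<forall>v. (\<forall>x. p x v = 0) \<longrightarrow> v = 0)"

section \<open>Dimensions of finite-dimensional spaces and their products\<close>

lemma finite_dim_basis:
  assumes "finite_dim TYPE('a::real_vector)"
  obtains B :: "'a::real_vector set" where "finite B" "independent B" "span B = UNIV"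
    "card B = dim (UNIV :: 'a::real_vector set)"
proof -
  obtain S :: "'a set" where S: "finite S" "span S = UNIV"
    using assms by (auto simp: finite_dim_def)
  obtain B where B: "B \<subseteq> S" "independent B" "S \<subseteq> span B"
    by (rule maximal_independent_subset)
  have "span B = UNIV"
    using S(2) B(3) by (metis span_mono span_span top.extremum_unique)
  moreover have "finite B" using B(1) S(1) by (rule finite_subset)
  ultimately show ?thesis using that B(2) by (metis basis_card_eq_dim subset_UNIV order_refl)
qed

lemma finite_dim_linear_image:
  fixes f :: "'a::real_vector \<Rightarrow> 'b::real_vector"
  assumes "finite_dim TYPE('a)" "linear f" "surj f"
  shows "finite_dim TYPE('b)"
proof -
  obtain S :: "'a set" where S: "finite S" "span S = UNIV"
    using assms(1) by (auto simp: finite_dim_def)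
  have "span (f ` S) = UNIV"
    using linear_span_image[OF assms(2)] S(2) assms(3) by simp
  with S(1) show ?thesis by (auto simp: finite_dim_def)
qed

lemma dim_injective_linear_image:
  fixes f :: "'a::real_vector \<Rightarrow> 'b::real_vector"
  assumes "finite_dim TYPE('a)" "linear f" "inj f"
  shows "dim (range f) = dim (UNIV :: 'a set)"
proof -
  obtain B :: "'a set" where B: "finite B" "independent B" "span B = UNIV" "card B = dim (UNIV :: 'a set)"
    using finite_dim_basis[OF assms(1)] .
  have "independent (f ` B)"
    using linear_independent_injective_image[OF assms(2) B(2)] assms(3) by (simp add: inj_on_def)
  moreover have "span (f ` B) = span (range f)"
    using linear_span_image[OF assms(2), of B] B(3) by (metis span_span)
  ultimately have "dim (range f) = card (f ` B)" by (simp add: dim_eq_card)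
  then show ?thesis using B(4) assms(3) by (simp add: card_image inj_on_subset)
qed

text \<open>The two summands are injective images of the factors and meet only in zero, so the
  dimension formula for sums and intersections applies. The Lagrangian condition thereby reduces to
  equality of \<open>dim\<close> on the two factors.\<close>

lemma dim_prod_UNIV:
  assumes "finite_dim TYPE('a::real_vector)" "finite_dim TYPE('b::real_vector)"
  shows "dim (UNIV :: ('a \<times> 'b) set) = dim (UNIV :: 'a set) + dim (UNIV :: 'b set)"
    and "dim (UNIV \<times> {0} :: ('a \<times> 'b) set) = dim (UNIV :: 'a set)"
    and "dim ({0} \<times> UNIV :: ('a \<times> 'b) set) = dim (UNIV :: 'b set)"
proof -
  let ?i = "\<lambda>x. (x, 0) :: 'a \<times> 'b" and ?j = "\<lambda>v. (0, v) :: 'a \<times> 'b"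
  have lin: "linear ?i" "linear ?j" by (auto simp: linear_iff)
  have ranges: "range ?i = UNIV \<times> {0}" "range ?j = {0} \<times> UNIV" by auto
  show di: "dim (UNIV \<times> {0} :: ('a \<times> 'b) set) = dim (UNIV :: 'a set)"
    using dim_injective_linear_image[OF assms(1) lin(1)] by (simp add: ranges inj_on_def)
  show dj: "dim ({0} \<times> UNIV :: ('a \<times> 'b) set) = dim (UNIV :: 'b set)"
    using dim_injective_linear_image[OF assms(2) lin(2)] by (simp add: ranges inj_on_def)
  obtain B :: "'a set" and C :: "'b set" where BC: "finite B" "span B = UNIV" "finite C" "span C = UNIV"
    using assms by (auto simp: finite_dim_def)
  have sub: "subspace (UNIV \<times> {0} :: ('a \<times> 'b) set)" "subspace ({0} \<times> UNIV :: ('a \<times> 'b) set)"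
    by (auto simp: subspace_def zero_prod_def)
  have sum: "{a + b |a b. a \<in> UNIV \<times> {0} \<and> b \<in> {0} \<times> UNIV} = (UNIV :: ('a \<times> 'b) set)"
    by (auto simp: set_eq_iff)
  have "span (?i ` B \<union> ?j ` C) = UNIV"
    using linear_span_image[OF lin(1), of B] linear_span_image[OF lin(2), of C] BC
    by (simp add: span_Un ranges sum)
  with BC have fd: "finite_dim TYPE('a \<times> 'b)"
    by (auto simp: finite_dim_def intro!: exI[of _ "?i ` B \<union> ?j ` C"])
  obtain D :: "('a \<times> 'b) set" where D: "finite D" "independent D" "span D = UNIV"
    by (rule finite_dim_basis[OF fd])
  \<comment> \<open>The dimension formula belongs to a locale that takes a finite basis as
    parameter; \<open>D\<close> is that basis.\<close>
  interpret fd: finite_dimensional_vector_space "scaleR :: real \<Rightarrow> 'a \<times> 'b \<Rightarrow> 'a \<times> 'b" D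
    using D by unfold_locales (auto simp: dependent_raw_def span_raw_def)
  have "dim (UNIV :: ('a \<times> 'b) set) + dim ((UNIV \<times> {0}) \<inter> ({0} \<times> UNIV) :: ('a \<times> 'b) set)
      = dim (UNIV \<times> {0} :: ('a \<times> 'b) set) + dim ({0} \<times> UNIV :: ('a \<times> 'b) set)"
    using fd.dim_sums_Int[folded dim_raw_def subspace_raw_def, OF sub] by (simp add: sum)
  moreover have "(UNIV \<times> {0}) \<inter> ({0} \<times> UNIV) = ({0} :: ('a \<times> 'b) set)" by (auto simp: zero_prod_def)
  moreover have "dim ({0} :: ('a \<times> 'b) set) = 0"
    using dim_eq_card[of "{}" "{0 :: 'a \<times> 'b}"] independent_empty by simp
  ultimately show "dim (UNIV :: ('a \<times> 'b) set) = dim (UNIV :: 'a set) + dim (UNIV :: 'b set)"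
    by (simp add: di dj)
qed

lemma finite_dim_isomorphism:
  assumes "finite_dim TYPE('a::real_vector)" "finite_dim TYPE('b::real_vector)"
    and "dim (UNIV :: 'a::real_vector set) = dim (UNIV :: 'b::real_vector set)"
  obtains f :: "'a::real_vector \<Rightarrow> 'b::real_vector" where "linear f" "bij f"
proof -
  obtain B :: "'a set" where B: "finite B" "independent B" "span B = UNIV" "card B = dim (UNIV :: 'a set)"
    using finite_dim_basis[OF assms(1)] .
  obtain C :: "'b set" where C: "finite C" "independent C" "span C = UNIV" "card C = dim (UNIV :: 'b set)"
    using finite_dim_basis[OF assms(2)] .
  obtain f where "linear f" "f ` UNIV = (UNIV :: 'b set)" "inj_on f (UNIV :: 'a set)"
    using finite_basis_to_basis_subspace_isomorphism[of "UNIV :: 'a set" "UNIV :: 'b set" B C] B C assms(3)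
    by (auto simp: subspace_UNIV)
  then show ?thesis using that by (simp add: bij_def)
qed

section \<open>Dual vectors and perfect pairings\<close>

text \<open>A Gram-Schmidt argument with a pairing in place of an inner product: each new vector
  gets a dual vector, and the old dual vectors are corrected at it.\<close>

lemma dual_vectors_exist:
  fixes p :: "'a::real_vector \<Rightarrow> 'b::real_vector \<Rightarrow> real"
  assumes "bilinear p" and nondeg: "\<And>v. (\<And>x. p x v = 0) \<Longrightarrow> v = 0"
    and "finite B" "independent B"
  shows "\<exists>e. \<forall>b\<in>B. \<forall>c\<in>B. p (e b) c = (if b = c then 1 else 0)"
  using assms(3,4)
proof (induction B)
  case (insert b B)
  note bil = bilinear_ladd[OF assms(1)] bilinear_lsub[OF assms(1)] bilinear_lmul[OF assms(1)]
    bilinear_rsub[OF assms(1)] bilinear_rmul[OF assms(1)]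
  have suml: "p (\<Sum>i\<in>B. f i) v = (\<Sum>i\<in>B. p (f i) v)" for f v
    using assms(1) by (auto simp: bilinear_def intro: linear_sum)
  have sumr: "p x (\<Sum>i\<in>B. f i) = (\<Sum>i\<in>B. p x (f i))" for f x
    using assms(1) by (auto simp: bilinear_def intro: linear_sum)
  have ind: "independent B" "b \<notin> span B"
    using insert by (auto simp: independent_insert)
  then obtain e where e: "\<And>b c. b \<in> B \<Longrightarrow> c \<in> B \<Longrightarrow> p (e b) c = (if b = c then 1 else 0)"
    using insert.IH by blast
  \<comment> \<open>This residue of \<open>b\<close> pairs to zero with every \<open>e c\<close> for
    \<open>c\<close> in \<open>B\<close>. It is nonzero because \<open>b\<close> lies outside
    \<open>span B\<close>, so some \<open>x\<close> detects it.\<close>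
  have "b - (\<Sum>i\<in>B. p (e i) b *\<^sub>R i) \<noteq> 0"
  proof
    have "(\<Sum>i\<in>B. p (e i) b *\<^sub>R i) \<in> span B" by (intro span_sum span_scale span_base)
    moreover assume "b - (\<Sum>i\<in>B. p (e i) b *\<^sub>R i) = 0"
    ultimately show False using ind(2) by simp
  qed
  then obtain x where x: "p x (b - (\<Sum>i\<in>B. p (e i) b *\<^sub>R i)) \<noteq> 0"
    using nondeg by blast
  \<comment> \<open>subtracting dual vectors makes \<open>x\<close> annihilate \<open>B\<close> without changing the pairing above\<close>
  define z where "z = x - (\<Sum>i\<in>B. p x i *\<^sub>R e i)"
  have zB: "p z c = 0" if "c \<in> B" for c
    using that insert.hyps(1) by (simp add: z_def bil suml e sum.delta' if_distrib cong: if_cong)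
  \<comment> \<open>By bilinearity \<open>p z b\<close> is the value of \<open>p x\<close> at the
    residue of \<open>b\<close>.\<close>
  have zb: "p z b \<noteq> 0"
    using x by (simp add: z_def bil suml sumr mult.commute)
  \<comment> \<open>Normalising \<open>z\<close> yields the dual vector of \<open>b\<close>. A
    multiple of \<open>z\<close> cancels the value of each old dual vector at \<open>b\<close> and,
    as \<open>z\<close> annihilates \<open>B\<close>, changes nothing on \<open>B\<close>.\<close>
  define e' where "e' i = (if i = b then (1 / p z b) *\<^sub>R z else e i - (p (e i) b / p z b) *\<^sub>R z)" for i
  have "p (e' i) c = (if i = c then 1 else 0)" if "i \<in> insert b B" "c \<in> insert b B" for i c
    using that zB zb insert.hyps(2) by (auto simp: e'_def bil e)
  then show ?case by blast
qed simp

lemma perfect_pairing_flip: "perfect_pairing p \<Longrightarrow> perfect_pairing (\<lambda>v x. p x v)"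
  by (auto simp: perfect_pairing_def bilinear_def)

lemma perfect_pairing_bilinear: "perfect_pairing p \<Longrightarrow> bilinear p"
  by (simp add: perfect_pairing_def)

lemma perfect_pairing_eqI:
  assumes "perfect_pairing p" "\<And>v. p x v = p y v"
  shows "x = y"
proof -
  have "\<forall>v. p (x - y) v = 0"
    using assms by (simp add: bilinear_lsub perfect_pairing_bilinear)
  then show ?thesis using assms(1) by (metis perfect_pairing_def eq_iff_diff_eq_0)
qed

lemmas perfect_pairing_eqI' = perfect_pairing_eqI[OF perfect_pairing_flip]

text \<open>The combination of dual vectors with coefficients \<open>\<alpha> b\<close> agrees with
  \<open>\<alpha>\<close> on a basis. Adjoints and transposes are obtained from this below.\<close>

lemma perfect_pairing_represents:
  fixes p :: "'a::real_vector \<Rightarrow> 'b::real_vector \<Rightarrow> real"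
  assumes p: "perfect_pairing p" and "finite_dim TYPE('b)" "linear \<alpha>"
  shows "\<exists>x. \<forall>v. p x v = \<alpha> v"
proof -
  obtain B :: "'b set" where B: "finite B" "independent B" "span B = UNIV"
    by (rule finite_dim_basis[OF assms(2)])
  obtain e where e: "\<And>b c. b \<in> B \<Longrightarrow> c \<in> B \<Longrightarrow> p (e b) c = (if b = c then 1 else 0)"
    using dual_vectors_exist[of p B] p B by (auto simp: perfect_pairing_def)
  let ?x = "\<Sum>b\<in>B. \<alpha> b *\<^sub>R e b"
  have lin: "linear (p x)" "linear (\<lambda>x. p x v)" for x v
    using p by (auto simp: perfect_pairing_def bilinear_def)
  have "p ?x c = \<alpha> c" if "c \<in> B" for c
    using that B(1) by (simp add: linear_sum[OF lin(2)] linear_scale[OF lin(2)] e if_distrib cong: if_cong)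
  then have "p ?x v = \<alpha> v" for v
    using linear_eq_on[OF lin(1) assms(3), of v B ?x] B(3) by simp
  then show ?thesis by blast
qed

text \<open>\<open>T\<close> sends a basis of \<open>'b\<close> to its dual vectors. Pairing
  \<open>T v\<close> with the basis reads off the coordinates of \<open>v\<close>, hence
  injectivity. Finite dimension of \<open>'a\<close> is a consequence, not an assumption.\<close>

lemma perfect_pairing_isomorphism:
  fixes p :: "'a::real_vector \<Rightarrow> 'b::real_vector \<Rightarrow> real"
  assumes p: "perfect_pairing p" and "finite_dim TYPE('b)"
  obtains T :: "'b::real_vector \<Rightarrow> 'a::real_vector" where "linear T" "bij T"
proof -
  obtain B :: "'b set" where B: "finite B" "independent B" "span B = UNIV"
    by (rule finite_dim_basis[OF assms(2)])
  obtain e where e: "\<And>b c. b \<in> B \<Longrightarrow> c \<in> B \<Longrightarrow> p (e b) c = (if b = c then 1 else 0)"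
    using dual_vectors_exist[of p B] p B by (auto simp: perfect_pairing_def)
  obtain T where T: "linear T" "\<And>b. b \<in> B \<Longrightarrow> T b = e b"
    using linear_independent_extend[OF B(2)] by metis
  have lin: "linear (p x)" "linear (\<lambda>x. p x v)" for x v
    using p by (auto simp: perfect_pairing_def bilinear_def)
  have pT: "p (T (\<Sum>b\<in>B. u b *\<^sub>R b)) c = u c" if "c \<in> B" for u c
    using that B(1) T
    by (simp add: linear_sum[OF T(1)] linear_scale[OF T(1)] linear_sum[OF lin(2)] linear_scale[OF lin(2)]
        e if_distrib cong: if_cong)
  have "v = 0" if "T v = 0" for v
  proof -
    have "v \<in> range (\<lambda>u. \<Sum>b\<in>B. u b *\<^sub>R b)"
      unfolding span_finite[OF B(1), symmetric] B(3) by (rule UNIV_I)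
    then obtain u where u: "v = (\<Sum>b\<in>B. u b *\<^sub>R b)" by (rule rangeE)
    have "u c = 0" if "c \<in> B" for c
      using pT[OF that, of u] \<open>T v = 0\<close> u linear_0[OF lin(2)] by simp
    then show ?thesis by (simp add: u)
  qed
  then have "inj T" using T(1) by (simp add: linear_injective_0)
  \<comment> \<open>The preimage of \<open>x\<close> has the values \<open>p x b\<close> as
    coordinates: its image pairs with \<open>B\<close> exactly as \<open>x\<close> does.\<close>
  moreover have "T (\<Sum>b\<in>B. p x b *\<^sub>R b) = x" for x
  proof (rule perfect_pairing_eqI[OF p])
    show "p (T (\<Sum>b\<in>B. p x b *\<^sub>R b)) v = p x v" for v
      by (rule linear_eq_on[OF lin(1) lin(1), of v B]) (use pT B(3) in auto)
  qed
  then have "surj T" by (rule surjI)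
  ultimately show ?thesis using that T(1) by (simp add: bij_def)
qed

lemma perfect_pairing_dim_eq:
  fixes p :: "'a::real_vector \<Rightarrow> 'b::real_vector \<Rightarrow> real"
  assumes "perfect_pairing p" "finite_dim TYPE('b)"
  shows "finite_dim TYPE('a)" "dim (UNIV :: 'a set) = dim (UNIV :: 'b set)"
proof -
  obtain T :: "'b \<Rightarrow> 'a" where "linear T" "bij T"
    using perfect_pairing_isomorphism[OF assms] .
  then show "finite_dim TYPE('a)" "dim (UNIV :: 'a set) = dim (UNIV :: 'b set)"
    using finite_dim_linear_image[of T] dim_injective_linear_image[of T] assms(2) by (auto simp: bij_def)
qed


section \<open>Symplectic forms from pairings\<close>

definition pairing_form :: "('g::real_vector \<Rightarrow> 'v::real_vector \<Rightarrow> real) \<Rightarrow> 'g \<times> 'v \<Rightarrow> 'g \<times> 'v \<Rightarrow> real" where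
  "pairing_form p = (\<lambda>(x, u) (y, v). p x v - p y u)"

lemma pairing_form_symplectic:
  assumes p: "perfect_pairing p" and adj: "\<And>x y v. p (\<gamma> x y) v = - p y (\<rho> x v)"
    and tf: "torsion_free br \<gamma>"
  shows "symplectic_form (semidirect br \<rho>) (pairing_form p)"
proof -
  note b = perfect_pairing_bilinear[OF p]
  note bil = bilinear_ladd[OF b] bilinear_lsub[OF b] bilinear_radd[OF b] bilinear_rsub[OF b]
    bilinear_lmul[OF b] bilinear_rmul[OF b] bilinear_lzero[OF b] bilinear_rzero[OF b]
  have "bilinear (pairing_form p)"
    by (auto simp: bilinear_def linear_iff pairing_form_def bil algebra_simps split: prod.split)
  moreover have "pairing_form p a a = 0" for a
    by (simp add: pairing_form_def split: prod.split)
  moreover have "nondegenerate (pairing_form p)"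
    unfolding nondegenerate_def
  proof (intro allI impI)
    fix a assume "\<forall>c. pairing_form p a c = 0"
    then have zero: "pairing_form p a c = 0" for c by blast
    obtain x u where a: "a = (x, u)" by (cases a)
    have "p x v = 0" for v using zero[of "(0, v)"] by (simp add: a pairing_form_def bil)
    moreover have "p y u = 0" for y using zero[of "(y, 0)"] by (simp add: a pairing_form_def bil)
    ultimately show "a = 0" using p by (simp add: a zero_prod_def perfect_pairing_def)
  qed
  moreover have "ce_diff2 (semidirect br \<rho>) (pairing_form p) a c d = 0" for a c d
  proof -
    \<comment> \<open>By \<open>adj\<close>, the differential at \<open>(x, 0)\<close>,
      \<open>(y, 0)\<close>, \<open>(0, v)\<close> is
      \<open>- p (br x y - \<gamma> x y + \<gamma> y x) v\<close>, so replacing the bracket makes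
      everything cancel.\<close>
    have "br x y = \<gamma> x y - \<gamma> y x" for x y
      using tf by (simp add: torsion_free_def algebra_simps eq_diff_eq)
    then show ?thesis
      by (simp add: ce_diff2_def semidirect_def pairing_form_def bil adj split: prod.split)
  qed
  ultimately show ?thesis by (simp add: symplectic_form_def two_form_def)
qed

lemma pairing_form_lagrangian:
  fixes p :: "'g::real_vector \<Rightarrow> 'v::real_vector \<Rightarrow> real"
  assumes p: "perfect_pairing p" and fd: "finite_dim TYPE('v)"
  shows "lagrangian_subspace (pairing_form p) (UNIV \<times> {0})"
    and "lagrangian_subspace (pairing_form p) ({0} \<times> UNIV)"
proof -
  note b = perfect_pairing_bilinear[OF p]
  note dims = perfect_pairing_dim_eq[OF p fd]
  show "lagrangian_subspace (pairing_form p) (UNIV \<times> {0})"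
    "lagrangian_subspace (pairing_form p) ({0} \<times> UNIV)"
    using dim_prod_UNIV[OF dims(1) fd] dims(2)
    by (auto simp: lagrangian_subspace_def pairing_form_def bilinear_lzero[OF b] bilinear_rzero[OF b]
        subspace_def zero_prod_def)
qed

section \<open>Connections and representations as adjoints\<close>

text \<open>Equality is tested by pairing, so linearity passes across the adjunction. With the
  flipped pairing the same lemma leads from connections back to representations.\<close>

lemma adjoint_bilinear:
  assumes p: "perfect_pairing p" and \<rho>: "bilinear \<rho>" and adj: "\<And>x y v. p (\<gamma> x y) v = - p y (\<rho> x v)"
  shows "bilinear \<gamma>"
proof -
  note b = perfect_pairing_bilinear[OF p]
  note bil = bilinear_ladd[OF b] bilinear_radd[OF b] bilinear_lmul[OF b] bilinear_rmul[OF b]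
    bilinear_ladd[OF \<rho>] bilinear_lmul[OF \<rho>]
  show ?thesis
    by (auto simp: bilinear_def linear_iff bil adj intro!: perfect_pairing_eqI[OF p])
qed

text \<open>Non-degeneracy gives uniqueness in the definite description and \<open>\<gamma>\<close>
  itself gives existence, so exhibiting any adjoint computes \<open>connection_of\<close>.\<close>

lemma connection_of_pairing_form:
  assumes p: "perfect_pairing p" and adj: "\<And>x y v. p (\<gamma> x y) v = - p y (\<rho> x v)"
  shows "connection_of (br, \<rho>, pairing_form p) = (br, \<gamma>)"
proof -
  note b = perfect_pairing_bilinear[OF p]
  have "(THE z. \<forall>v. p z v = - p y (\<rho> x v)) = \<gamma> x y" for x y
    by (rule the_equality) (auto simp: adj intro!: perfect_pairing_eqI[OF p])
  then show ?thesis
    by (simp add: connection_of_def pairing_form_def bilinear_lzero[OF b] bilinear_rzero[OF b])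
qed

lemma lagrangian_products_pairing_formI:
  fixes p :: "'g::real_vector \<Rightarrow> 'v::real_vector \<Rightarrow> real"
  assumes C: "(br, \<gamma>) \<in> flat_torsion_free_connections"
    and p: "perfect_pairing p" and fd: "finite_dim TYPE('v)"
    and adj: "\<And>x y v. p (\<gamma> x y) v = - p y (\<rho> x v)"
  shows "(br, \<rho>, pairing_form p) \<in> lagrangian_products"
proof -
  have "bilinear \<gamma>" and flat: "flat br \<gamma>" and "torsion_free br \<gamma>" "lie_algebra br"
    using C by (auto simp: flat_torsion_free_connections_def connection_def)
  have adj': "p y (\<rho> x v) = - p (\<gamma> x y) v" for x y v by (simp add: adj)
  note b = perfect_pairing_bilinear[OF p]
  have "bilinear \<rho>"
    using adjoint_bilinear[OF perfect_pairing_flip[OF p] \<open>bilinear \<gamma>\<close>, of \<rho>] adj'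
    by blast
  moreover have "\<rho> (br x y) v = \<rho> x (\<rho> y v) - \<rho> y (\<rho> x v)" for x y v
  proof (rule perfect_pairing_eqI'[OF p])
    \<comment> \<open>Two adjoints reverse the order of composition and their signs cancel; the
      single minus sign from \<open>br x y\<close> makes up for the reversal.\<close>
    have "\<gamma> (br x y) z = \<gamma> x (\<gamma> y z) - \<gamma> y (\<gamma> x z)" for z
      using flat by (simp add: flat_def algebra_simps eq_diff_eq)
    then show "p z (\<rho> (br x y) v) = p z (\<rho> x (\<rho> y v) - \<rho> y (\<rho> x v))" for z
      by (simp add: adj' bilinear_rsub[OF b] bilinear_lsub[OF b])
  qed
  ultimately have "representation br \<rho>" by (simp add: representation_def)
  then show ?thesis
    using pairing_form_symplectic[OF p adj \<open>torsion_free br \<gamma>\<close>] pairing_form_lagrangian[OF p fd]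
      \<open>lie_algebra br\<close> fd
    by (simp add: lagrangian_products_def)
qed

text \<open>Normal form for arguments that start from a given product. Isotropy of the summands
  leaves only the mixed block \<open>p\<close> of the form, and non-degeneracy of the form becomes
  perfectness of \<open>p\<close>.\<close>

lemma lagrangian_productsE:
  fixes L :: "('g::real_vector, 'v::real_vector) prod_data"
  assumes "L \<in> lagrangian_products"
  obtains br \<rho> p \<gamma> where "L = (br, \<rho>, pairing_form p)" "perfect_pairing p" "bilinear \<rho>"
    "finite_dim TYPE('v::real_vector)" "\<And>x y v. p (\<gamma> x y) v = - p y (\<rho> x v)"
    "(br, \<gamma>) \<in> flat_torsion_free_connections" "connection_of L = (br, \<gamma>)"
proof -
  obtain br \<rho> \<omega> where L: "L = (br, \<rho>, \<omega>)" by (cases L)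
  have lie: "lie_algebra br" and fd: "finite_dim TYPE('v)" and rep: "representation br \<rho>"
    and symp: "symplectic_form (semidirect br \<rho>) \<omega>"
    and lag: "lagrangian_subspace \<omega> (UNIV \<times> {0})" "lagrangian_subspace \<omega> ({0} \<times> UNIV)"
    using assms by (auto simp: L lagrangian_products_def)
  have \<rho>: "bilinear \<rho>" using rep by (simp add: representation_def)
  have \<omega>: "bilinear \<omega>" and alt: "\<omega> a a = 0" and nondeg: "(\<And>c. \<omega> a c = 0) \<Longrightarrow> a = 0"
    and closed: "ce_diff2 (semidirect br \<rho>) \<omega> a c d = 0" for a c d
    using symp unfolding symplectic_form_def two_form_def nondegenerate_def by blast+
  have skew: "\<omega> a c = - \<omega> c a" for a c
    using alt[of "a + c"] unfolding bilinear_ladd[OF \<omega>] bilinear_radd[OF \<omega>] by (simp add: alt)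
  have iso: "\<omega> (x, 0) (y, 0) = 0" "\<omega> (0, u) (0, v) = 0" for x y u v
    using lag by (auto simp: lagrangian_subspace_def)
  define p where "p x v = \<omega> (x, 0) (0, v)" for x v
  have form: "\<omega> = pairing_form p"
  proof (intro ext)
    fix a c :: "'g \<times> 'v"
    obtain x u y v where ac: "a = (x, u)" "c = (y, v)" by (cases a, cases c)
    \<comment> \<open>Of the four terms of the expansion, isotropy kills two; \<open>skew\<close>
      brings the remaining term with \<open>u\<close> to the form \<open>- p y u\<close>.\<close>
    have "\<omega> ((x, 0) + (0, u)) ((y, 0) + (0, v)) = p x v - p y u"
      using skew[of "(0, u)" "(y, 0)"]
      by (simp only: bilinear_ladd[OF \<omega>] bilinear_radd[OF \<omega>] iso) (simp add: p_def)
    then show "\<omega> a c = pairing_form p a c" by (simp add: ac pairing_form_def)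
  qed
  have "bilinear p"
    unfolding bilinear_def
  proof (intro conjI allI)
    show "linear (p x)" for x
      using bilinear_radd[OF \<omega>, of "(x, 0)" "(0, u)" "(0, v)" for u v]
        bilinear_rmul[OF \<omega>, of "(x, 0)" c "(0, v)" for c v]
      by (simp add: p_def linear_iff)
    show "linear (\<lambda>x. p x v)" for v
      using bilinear_ladd[OF \<omega>, of "(x, 0)" "(y, 0)" "(0, v)" for x y]
        bilinear_lmul[OF \<omega>, of c "(x, 0)" "(0, v)" for c x]
      by (simp add: p_def linear_iff)
  qed
  then have p0: "p x 0 = 0" "p 0 v = 0" for x v
    by (simp_all add: bilinear_lzero bilinear_rzero)
  have p: "perfect_pairing p"
    unfolding perfect_pairing_def
  proof (intro conjI allI impI \<open>bilinear p\<close>)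
    show "x = 0" if "\<forall>v. p x v = 0" for x
      using nondeg[of "(x, 0)"] that by (auto simp: form pairing_form_def p0 zero_prod_def)
    show "v = 0" if "\<forall>x. p x v = 0" for v
      using nondeg[of "(0, v)"] that by (auto simp: form pairing_form_def p0 zero_prod_def)
  qed
  have ex: "\<exists>z. \<forall>v. p z v = - p y (\<rho> x v)" for x y
  proof -
    have "linear (\<lambda>v. - p y (\<rho> x v))"
      using \<rho> \<open>bilinear p\<close> by (simp add: linear_iff bilinear_radd bilinear_rmul)
    then show ?thesis by (rule perfect_pairing_represents[OF p fd])
  qed
  \<comment> \<open>The choice is harmless: \<open>p\<close> admits only one such vector, so the
    result agrees with \<open>connection_of\<close>.\<close>
  define \<gamma> where "\<gamma> x y = (SOME z. \<forall>v. p z v = - p y (\<rho> x v))" for x y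
  have adj: "p (\<gamma> x y) v = - p y (\<rho> x v)" for x y v
    using someI_ex[OF ex[of y x]] by (simp add: \<gamma>_def)
  note b = bilinear_ladd[OF \<open>bilinear p\<close>] bilinear_lsub[OF \<open>bilinear p\<close>] bilinear_rsub[OF \<open>bilinear p\<close>]
  have "bilinear \<gamma>" by (rule adjoint_bilinear[OF p \<rho>]) (rule adj)
  moreover have "torsion_free br \<gamma>"
    unfolding torsion_free_def
  proof (intro allI)
    fix x y
    show "br x y - \<gamma> x y + \<gamma> y x = 0"
    proof (rule perfect_pairing_eqI[OF p])
      fix v
      \<comment> \<open>Up to sign, the left side is the differential of the form at two vectors of
        the subalgebra and one of the ideal.\<close>
      show "p (br x y - \<gamma> x y + \<gamma> y x) v = p 0 v"
        using closed[of "(x, 0)" "(y, 0)" "(0, v)"]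
        by (simp add: ce_diff2_def semidirect_def form pairing_form_def p0 adj b
            bilinear_rzero[OF \<rho>] bilinear_lzero[OF \<rho>])
    qed
  qed
  moreover have "flat br \<gamma>"
    unfolding flat_def
  proof (intro allI)
    fix x y z
    show "\<gamma> (br x y) z - \<gamma> x (\<gamma> y z) + \<gamma> y (\<gamma> x z) = 0"
    proof (rule perfect_pairing_eqI[OF p])
      fix v
      show "p (\<gamma> (br x y) z - \<gamma> x (\<gamma> y z) + \<gamma> y (\<gamma> x z)) v = p 0 v"
        using rep by (simp add: representation_def p0 adj b)
    qed
  qed
  ultimately have C: "(br, \<gamma>) \<in> flat_torsion_free_connections"
    using lie by (simp add: flat_torsion_free_connections_def connection_def)
  show ?thesis
  proof (rule that[of br \<rho> p \<gamma>])
    show L': "L = (br, \<rho>, pairing_form p)" by (simp add: L form)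
    show "connection_of L = (br, \<gamma>)"
      unfolding L' by (rule connection_of_pairing_form[OF p]) (rule adj)
  qed (fact p \<rho> fd adj C)+
qed

section \<open>Isomorphisms of products and of connections\<close>

text \<open>Evaluation at vectors of a single summand separates the conditions on the blocks; the
  converse expands in components, with linearity of \<open>\<phi>\<close> handling the difference in
  the bracket.\<close>

lemma prod_isomorphism_iff:
  assumes p: "perfect_pairing p" "perfect_pairing p'" and \<rho>: "bilinear \<rho>" "bilinear \<rho>'"
  shows "prod_isomorphism f \<phi> (br, \<rho>, pairing_form p) (br', \<rho>', pairing_form p') \<longleftrightarrow>
    linear f \<and> bij f \<and> linear \<phi> \<and> bij \<phi> \<and> (\<forall>x y. f (br x y) = br' (f x) (f y)) \<and>
    (\<forall>x v. \<phi> (\<rho> x v) = \<rho>' (f x) (\<phi> v)) \<and> (\<forall>x v. p' (f x) (\<phi> v) = p x v)"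
    (is "?lhs \<longleftrightarrow> ?rhs")
proof
  note b = p[THEN perfect_pairing_bilinear]
  note zero = b[THEN bilinear_lzero] b[THEN bilinear_rzero] \<rho>[THEN bilinear_lzero] \<rho>[THEN bilinear_rzero]
  {
    assume ?lhs
    then have lin: "linear f" "bij f" "linear \<phi>" "bij \<phi>"
      and hom: "map_prod f \<phi> (semidirect br \<rho> a c) = semidirect br' \<rho>' (map_prod f \<phi> a) (map_prod f \<phi> c)"
      and form: "pairing_form p' (map_prod f \<phi> a) (map_prod f \<phi> c) = pairing_form p a c" for a c
      by (auto simp: prod_isomorphism_def simp del: split_paired_All)
    note f0 = linear_0[OF lin(1)] linear_0[OF lin(3)]
    have "f (br x y) = br' (f x) (f y)" for x y
      using hom[of "(x, 0)" "(y, 0)"] by (simp add: semidirect_def)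
    moreover have "\<phi> (\<rho> x v) = \<rho>' (f x) (\<phi> v)" for x v
      using hom[of "(x, 0)" "(0, v)"] by (simp add: semidirect_def zero f0)
    moreover have "p' (f x) (\<phi> v) = p x v" for x v
      using form[of "(x, 0)" "(0, v)"] by (simp add: pairing_form_def zero f0)
    ultimately show ?rhs using lin by blast
  next
    assume ?rhs
    then show ?lhs
      by (auto simp: prod_isomorphism_def semidirect_def pairing_form_def linear_diff)
  }
qed

text \<open>For \<open>f = id\<close> this says that products over a fixed Lie algebra are
  equivalent exactly when their connections coincide, which gives the bijection on classes.\<close>

lemma conn_isomorphism_iff_prod_isomorphism:
  fixes L :: "('g::real_vector, 'v::real_vector) prod_data"
    and L' :: "('h::real_vector, 'w::real_vector) prod_data"
  assumes "L \<in> lagrangian_products" "L' \<in> lagrangian_products"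
  shows "conn_isomorphism f (connection_of L) (connection_of L') \<longleftrightarrow> (\<exists>\<phi>. prod_isomorphism f \<phi> L L')"
proof -
  obtain br \<rho> p \<gamma> where L: "L = (br, \<rho>, pairing_form p)" and p: "perfect_pairing p" and \<rho>: "bilinear \<rho>"
    and fd: "finite_dim TYPE('v)" and adj: "\<And>x y v. p (\<gamma> x y) v = - p y (\<rho> x v)"
    and "(br, \<gamma>) \<in> flat_torsion_free_connections" and C: "connection_of L = (br, \<gamma>)"
    by (rule lagrangian_productsE[OF assms(1)]) (rule that)
  obtain br' \<rho>' p' \<gamma>' where L': "L' = (br', \<rho>', pairing_form p')" and p': "perfect_pairing p'"
    and \<rho>': "bilinear \<rho>'" and fd': "finite_dim TYPE('w)"
    and adj': "\<And>x y v. p' (\<gamma>' x y) v = - p' y (\<rho>' x v)" 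
    and "(br', \<gamma>') \<in> flat_torsion_free_connections" and C': "connection_of L' = (br', \<gamma>')"
    by (rule lagrangian_productsE[OF assms(2)]) (rule that)
  note iff = prod_isomorphism_iff[OF p p' \<rho> \<rho>', of f _ br br']
  note b = perfect_pairing_bilinear[OF p] and b' = perfect_pairing_bilinear[OF p']
  show ?thesis
  proof
    assume "\<exists>\<phi>. prod_isomorphism f \<phi> L L'"
    then obtain \<phi> where lin: "linear f" "bij f" "bij \<phi>" and br: "\<And>x y. f (br x y) = br' (f x) (f y)"
      and \<phi>: "\<And>x v. \<phi> (\<rho> x v) = \<rho>' (f x) (\<phi> v)" "\<And>x v. p' (f x) (\<phi> v) = p x v"
      unfolding L L' iff by blast
    have "f (\<gamma> x y) = \<gamma>' (f x) (f y)" for x y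
    proof (rule perfect_pairing_eqI[OF p'])
      fix w
      \<comment> \<open>Since \<open>\<phi>\<close> is onto, testing against its values suffices,
        and there \<open>p'\<close> turns into \<open>p\<close>.\<close>
      obtain v where w: "w = \<phi> v" using lin(3) by (metis bij_pointE)
      show "p' (f (\<gamma> x y)) w = p' (\<gamma>' (f x) (f y)) w"
        by (simp add: w adj adj' \<phi> flip: \<phi>(1))
    qed
    then show "conn_isomorphism f (connection_of L) (connection_of L')"
      using lin br by (simp add: C C' conn_isomorphism_def)
  next
    assume "conn_isomorphism f (connection_of L) (connection_of L')"
    then have f: "linear f" "bij f" and br: "\<And>x y. f (br x y) = br' (f x) (f y)"
      and f\<gamma>: "\<And>x y. f (\<gamma> x y) = \<gamma>' (f x) (f y)"
      by (auto simp: C C' conn_isomorphism_def)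
    \<comment> \<open>Pulling \<open>p'\<close> back along \<open>f\<close> pairs \<open>'g\<close>
      with \<open>'w\<close>. The inverse transpose of \<open>f\<close> is then the solution
      \<open>\<phi>\<close> of \<open>q x (\<phi> v) = p x v\<close>.\<close>
    define q where "q x w = p' (f x) w" for x w
    have surj_f: "\<exists>x. y = f x" for y using f(2) by (metis bij_pointE)
    have "bilinear q"
      using b' f(1) by (simp add: bilinear_def q_def[abs_def] linear_iff)
    moreover have "x = 0" if "\<forall>w. q x w = 0" for x
    proof -
      have "f x = 0" using that p' by (simp add: q_def perfect_pairing_def)
      then show "x = 0" using f by (metis bij_is_inj injD linear_0)
    qed
    moreover have "w = 0" if "\<forall>x. q x w = 0" for w
      using that p' surj_f unfolding q_def perfect_pairing_def by metis
    ultimately have q: "perfect_pairing q" by (simp add: perfect_pairing_def)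
    have fdg: "finite_dim TYPE('g)" by (rule perfect_pairing_dim_eq(1)[OF p fd])
    have "\<exists>w. \<forall>x. q x w = p x v" for v
      using b by (intro perfect_pairing_represents[OF perfect_pairing_flip[OF q] fdg]) (simp add: bilinear_def)
    then obtain \<phi> where \<phi>: "\<And>x v. q x (\<phi> v) = p x v" by metis
    \<comment> \<open>Exchanging \<open>p\<close> and \<open>q\<close> produces the inverse of
      \<open>\<phi>\<close>.\<close>
    have "\<exists>v. \<forall>x. p x v = q x w" for w
      using \<open>bilinear q\<close>
      by (intro perfect_pairing_represents[OF perfect_pairing_flip[OF p] fdg]) (simp add: bilinear_def)
    then obtain \<psi> where \<psi>: "\<And>x w. p x (\<psi> w) = q x w" by metis
    note bil = bilinear_radd[OF b] bilinear_rmul[OF b] bilinear_radd[OF \<open>bilinear q\<close>]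
      bilinear_rmul[OF \<open>bilinear q\<close>]
    have "linear \<phi>"
      by (auto simp: linear_iff bil \<phi> intro!: perfect_pairing_eqI'[OF q])
    moreover have "bij \<phi>"
      by (rule o_bij[of \<psi>])
        (auto simp: fun_eq_iff \<phi> \<psi> intro!: perfect_pairing_eqI'[OF q] perfect_pairing_eqI'[OF p])
    moreover have "\<phi> (\<rho> x v) = \<rho>' (f x) (\<phi> v)" for x v
    proof (rule perfect_pairing_eqI'[OF q])
      fix y
      have "q y (\<phi> (\<rho> x v)) = - q (\<gamma> x y) (\<phi> v)" by (simp add: \<phi> adj)
      also have "\<dots> = q y (\<rho>' (f x) (\<phi> v))" by (simp add: q_def f\<gamma> adj')
      finally show "q y (\<phi> (\<rho> x v)) = q y (\<rho>' (f x) (\<phi> v))" .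
    qed
    ultimately have "prod_isomorphism f \<phi> L L'"
      using f br \<phi> unfolding L L' iff q_def by blast
    then show "\<exists>\<phi>. prod_isomorphism f \<phi> L L'" by blast
  qed
qed

section \<open>The canonical product on the dual and its transport\<close>

lemma dual_apply_linear: "linear (dual_apply \<alpha>)"
  using dual_apply by blast

text \<open>Only separation of vectors needs an argument: a nonzero \<open>x\<close> is independent,
  so the value 1 at \<open>x\<close> extends to a linear functional.\<close>

lemma perfect_pairing_dual: "perfect_pairing (\<lambda>x \<alpha>. dual_apply \<alpha> x)"
  unfolding perfect_pairing_def
proof (intro conjI allI impI)
  show "bilinear (\<lambda>x \<alpha>. dual_apply \<alpha> x)"
    by (simp add: bilinear_def dual_apply_linear)
      (simp add: linear_iff plus_dual.rep_eq scaleR_dual.rep_eq)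
  show "x = 0" if "\<forall>\<alpha>. dual_apply \<alpha> x = 0" for x :: 'a
  proof (rule ccontr)
    assume "x \<noteq> 0"
    then have "independent {x}" by simp
    then obtain g :: "'a \<Rightarrow> real" where "linear g" "g x = 1"
      using linear_independent_extend[of "{x}" "\<lambda>_. 1"] by auto
    then show False using that by (metis Dual_inverse mem_Collect_eq zero_neq_one)
  qed
  show "\<alpha> = 0" if "\<forall>x. dual_apply \<alpha> x = 0" for \<alpha> :: "'a dual"
    using that by (simp add: zero_dual.rep_eq fun_eq_iff flip: dual_apply_inject)
qed

lemma canonical_form_eq: "canonical_form = pairing_form (\<lambda>x \<alpha>. dual_apply \<alpha> x)"
  by (simp add: canonical_form_def pairing_form_def)

lemma dual_connection_apply:
  assumes "bilinear \<gamma>"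
  shows "dual_apply (dual_connection \<gamma> x \<alpha>) y = - dual_apply \<alpha> (\<gamma> x y)"
proof -
  have "linear (\<lambda>y. - dual_apply \<alpha> (\<gamma> x y))"
    using assms dual_apply_linear[of \<alpha>] by (simp add: bilinear_def linear_iff)
  then show ?thesis by (simp add: dual_connection_def Dual_inverse)
qed

lemma finite_dim_dual:
  assumes "finite_dim TYPE('g::real_vector)"
  shows "finite_dim TYPE('g dual)" "dim (UNIV :: 'g dual set) = dim (UNIV :: 'g set)"
  using perfect_pairing_dim_eq[OF perfect_pairing_flip[OF perfect_pairing_dual] assms] by auto

lemma product_of_lagrangian:
  fixes C :: "'g::real_vector conn_data"
  assumes "C \<in> flat_torsion_free_connections"
  shows "product_of C \<in> lagrangian_products" "connection_of (product_of C) = C"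
proof -
  obtain br \<gamma> where C: "C = (br, \<gamma>)" by (cases C)
  have \<gamma>: "bilinear \<gamma>" and fd: "finite_dim TYPE('g dual)"
    using assms finite_dim_dual(1)
    by (auto simp: C flat_torsion_free_connections_def connection_def lie_algebra_def)
  have adj: "dual_apply \<alpha> (\<gamma> x y) = - dual_apply (dual_connection \<gamma> x \<alpha>) y" for x y \<alpha>
    by (simp add: dual_connection_apply[OF \<gamma>])
  note p = perfect_pairing_dual[where 'a = 'g]
  show "product_of C \<in> lagrangian_products" "connection_of (product_of C) = C"
    using lagrangian_products_pairing_formI[OF assms[unfolded C] p fd, OF adj]
      connection_of_pairing_form[OF p, of \<gamma> "dual_connection \<gamma>" br, OF adj]
    by (simp_all add: C product_of_def canonical_form_eq)
qed

text \<open>\<open>product_of\<close> lives on the dual, whereas the bijection fixes the type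
  \<open>'v\<close>. Equal dimension gives a linear isomorphism \<open>\<psi>\<close> onto the dual,
  along which the canonical product is transported.\<close>

lemma connection_of_surj:
  fixes C :: "'g::real_vector conn_data"
  assumes C_in: "C \<in> flat_torsion_free_connections"
    and fd: "finite_dim TYPE('v)" and dim: "dim (UNIV :: 'v set) = dim (UNIV :: 'g set)"
  shows "\<exists>L \<in> (lagrangian_products :: ('g, 'v::real_vector) prod_data set). connection_of L = C"
proof -
  obtain br \<gamma> where C: "C = (br, \<gamma>)" by (cases C)
  have \<gamma>: "bilinear \<gamma>" and fdg: "finite_dim TYPE('g)"
    using C_in by (auto simp: C flat_torsion_free_connections_def connection_def lie_algebra_def)
  obtain \<psi> :: "'v \<Rightarrow> 'g dual" where \<psi>: "linear \<psi>" "bij \<psi>"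
    by (rule finite_dim_isomorphism[OF fd finite_dim_dual(1)[OF fdg] dim[folded finite_dim_dual(2)[OF fdg]]])
  define p where "p x v = dual_apply (\<psi> v) x" for x v
  \<comment> \<open>The dual connection conjugated by \<open>\<psi>\<close>, so that the adjunction
    for \<open>p\<close> is the one for evaluation.\<close>
  define \<rho> where "\<rho> x v = inv \<psi> (dual_connection \<gamma> x (\<psi> v))" for x v
  have pd: "perfect_pairing (\<lambda>(x :: 'g) \<alpha>. dual_apply \<alpha> x)" by (rule perfect_pairing_dual)
  have "bilinear p"
    using perfect_pairing_bilinear[OF pd] \<psi>(1) by (simp add: bilinear_def p_def[abs_def] linear_iff)
  moreover have "x = 0" if "\<forall>v. p x v = 0" for x
  proof -
    have "dual_apply \<alpha> x = 0" for \<alpha> using that \<psi>(2) unfolding p_def by (metis bij_pointE)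
    then show ?thesis using pd by (simp add: perfect_pairing_def)
  qed
  moreover have "v = 0" if "\<forall>x. p x v = 0" for v
  proof -
    have "\<psi> v = 0" using that pd by (simp add: perfect_pairing_def p_def)
    then show ?thesis using \<psi> by (metis bij_is_inj injD linear_0)
  qed
  ultimately have p: "perfect_pairing p" by (simp add: perfect_pairing_def)
  have adj: "p (\<gamma> x y) v = - p y (\<rho> x v)" for x y v
    using \<psi>(2) by (simp add: p_def \<rho>_def dual_connection_apply[OF \<gamma>] surj_f_inv_f bij_is_surj)
  show ?thesis
    using lagrangian_products_pairing_formI[OF C_in[unfolded C] p fd, OF adj]
      connection_of_pairing_form[OF p, of \<gamma> \<rho> br, OF adj] C by blast
qed

section \<open>Equivalence classes as fibres of \<open>connection_of\<close>\<close>

lemma conn_isomorphism_id_iff: "conn_isomorphism id C C' \<longleftrightarrow> C = C'"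
  by (auto simp: conn_isomorphism_def linear_id fun_eq_iff split: prod.splits)

lemma lagrangian_equiv_eq_kernel:
  "lagrangian_equiv = {(L, L'). L \<in> lagrangian_products \<and> L' \<in> lagrangian_products \<and>
     connection_of L = connection_of L'}"
proof -
  have "L \<in> lagrangian_products \<and> L' \<in> lagrangian_products \<and> (\<exists>\<phi>. prod_isomorphism id \<phi> L L') \<longleftrightarrow>
      L \<in> lagrangian_products \<and> L' \<in> lagrangian_products \<and> connection_of L = connection_of L'"
    for L L' :: "('a, 'b) prod_data"
    using conn_isomorphism_iff_prod_isomorphism[of L L' id] by (auto simp: conn_isomorphism_id_iff)
  then show ?thesis by (simp add: lagrangian_equiv_def)
qed

text \<open>The classes are the fibres of \<open>f\<close> on \<open>A\<close>, so the image of each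
  class is a singleton and \<open>the_elem\<close> extracts its value.\<close>

lemma bij_betw_quotient_kernel:
  assumes "f ` A = B"
  shows "bij_betw (\<lambda>K. the_elem (f ` K)) (A // {(x, y). x \<in> A \<and> y \<in> A \<and> f x = f y}) B"
proof -
  let ?r = "{(x, y). x \<in> A \<and> y \<in> A \<and> f x = f y}"
  have cls: "?r `` {x} = {y \<in> A. f x = f y}" "f ` {y \<in> A. f x = f y} = {f x}" if "x \<in> A" for x
    using that by auto
  show ?thesis
    using assms by (auto simp: bij_betw_def inj_on_def quotient_def cls image_UN)
qed

text \<open>\<open>product_of\<close> inverts \<open>connection_of\<close> exactly on one side and
  up to isomorphism on the other. The dimension premise for the bijection reflects that a perfect
  pairing forces equal dimensions: on a space of another dimension there are no Lagrangian
  products.\<close>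

theorem proposition3p5:
  shows
    "(\<forall>L \<in> (lagrangian_products :: ('g::real_vector, 'v::real_vector) prod_data set).
        connection_of L \<in> flat_torsion_free_connections \<and>
        (case (L, connection_of L) of ((br, \<rho>, \<omega>), (br', \<gamma>)) \<Rightarrow>
           \<forall>x y v. \<omega> (\<gamma> x y, 0) (0, v) = - \<omega> (y, 0) (0, \<rho> x v))) \<and>
     (\<forall>C \<in> (flat_torsion_free_connections :: 'g conn_data set).
        product_of C \<in> lagrangian_products \<and> connection_of (product_of C) = C) \<and>
     (\<forall>L \<in> (lagrangian_products :: ('g, 'v) prod_data set).
        \<exists>\<phi>. prod_isomorphism id \<phi> L (product_of (connection_of L))) \<and>
     (\<forall>L \<in> (lagrangian_products :: ('g, 'v) prod_data set).
      \<forall>L' \<in> (lagrangian_products :: ('h::real_vector, 'w::real_vector) prod_data set).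
      \<forall>f. conn_isomorphism f (connection_of L) (connection_of L') \<longleftrightarrow>
          (\<exists>\<phi>. prod_isomorphism f \<phi> L L')) \<and>
     (finite_dim TYPE('v) \<and> dim (UNIV :: 'v set) = dim (UNIV :: 'g set) \<longrightarrow>
        bij_betw (\<lambda>K. the_elem (connection_of ` K))
          (lagrangian_products // (lagrangian_equiv :: (('g, 'v) prod_data \<times> ('g, 'v) prod_data) set))
          (flat_torsion_free_connections :: 'g conn_data set))"
proof -
  have conn: "connection_of L \<in> flat_torsion_free_connections \<and>
      (case (L, connection_of L) of ((br, \<rho>, \<omega>), (br', \<gamma>)) \<Rightarrow>
         \<forall>x y v. \<omega> (\<gamma> x y, 0) (0, v) = - \<omega> (y, 0) (0, \<rho> x v))"
    if "L \<in> (lagrangian_products :: ('g, 'v) prod_data set)" for L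
    using that
  proof (rule lagrangian_productsE)
    fix br \<rho> p \<gamma>
    assume L: "L = (br, \<rho>, pairing_form p)" and p: "perfect_pairing p"
      and adj: "\<And>x y v. p (\<gamma> x y) v = - p y (\<rho> x v)"
      and C: "(br, \<gamma>) \<in> flat_torsion_free_connections" "connection_of L = (br, \<gamma>)"
    note b = perfect_pairing_bilinear[OF p]
    show ?thesis
      unfolding C(2) using C(1)
      by (simp add: L pairing_form_def adj bilinear_lzero[OF b] bilinear_rzero[OF b])
  qed
  have iso: "\<exists>\<phi>. prod_isomorphism id \<phi> L (product_of (connection_of L))"
    if "L \<in> (lagrangian_products :: ('g, 'v) prod_data set)" for L
  proof -
    \<comment> \<open>\<open>L\<close> and the canonical product of its connection have the same
      connection, so the identity lifts to an isomorphism of products.\<close>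
    note C = product_of_lagrangian[OF conjunct1[OF conn[OF that]]]
    show ?thesis
      using conn_isomorphism_iff_prod_isomorphism[OF that C(1), of id]
      by (simp add: C(2) conn_isomorphism_id_iff)
  qed
  have bij: "bij_betw (\<lambda>K. the_elem (connection_of ` K))
      (lagrangian_products // (lagrangian_equiv :: (('g, 'v) prod_data \<times> ('g, 'v) prod_data) set))
      (flat_torsion_free_connections :: 'g conn_data set)"
    if fd: "finite_dim TYPE('v)" "dim (UNIV :: 'v set) = dim (UNIV :: 'g set)"
  proof -
    have "connection_of ` (lagrangian_products :: ('g, 'v) prod_data set) = flat_torsion_free_connections"
    proof (intro equalityI image_subsetI subsetI)
      show "C \<in> connection_of ` (lagrangian_products :: ('g, 'v) prod_data set)"
        if "C \<in> flat_torsion_free_connections" for C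
        using connection_of_surj[OF that fd] by blast
    qed (use conn in blast)
    then show ?thesis
      unfolding lagrangian_equiv_eq_kernel by (rule bij_betw_quotient_kernel)
  qed
  show ?thesis
    using conn product_of_lagrangian iso bij
    by (intro conjI ballI allI impI conn_isomorphism_iff_prod_isomorphism) simp_all
qed

end
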